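(* For every irrational number $\alpha$, $$\liminf_{n\to\infty} n\,\|\gamma-n\alpha\|'=0$$ holds for Lebesgue almost every $\gamma\in\mathbb{R}$.
   Context: For $n\in\mathbb{N}$ and $x,\alpha\in\mathbb{R}$, define $\|x-n\alpha\|'=\min\{|x-n\alpha-m|: m\in\mathbb{Z},\ \gcd(n,m)=1\}$. *)

theory Defs
  imports "HOL-Analysis.Analysis"
begin

text \<open>
  The distance \<open>\<parallel>x - n\<alpha>\<parallel>'\<close> from \<open>x - n\<alpha>\<close> to the nearest integer coprime to \<open>n\<close>.
  The infimum is a minimum, as \<open>coprime_dist_attained\<close> and \<open>coprime_dist_le\<close> show.
\<close>

definition coprime_dist :: "nat \<Rightarrow> real \<Rightarrow> real \<Rightarrow> real" where
  "coprime_dist n x \<alpha> =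
     Inf {\<bar>x - real n * \<alpha> - of_int m\<bar> | m :: int. gcd (int n) m = 1}"

lemma coprime_dist_le:
  assumes "gcd (int n) m = 1"
  shows "coprime_dist n x \<alpha> \<le> \<bar>x - real n * \<alpha> - of_int m\<bar>"
  unfolding coprime_dist_def
proof (rule cInf_lower)
  show "\<bar>x - real n * \<alpha> - of_int m\<bar> \<in>
      {\<bar>x - real n * \<alpha> - of_int m\<bar> | m :: int. gcd (int n) m = 1}"
    using assms by (intro CollectI exI[of _ m]) simp
  show "bdd_below {\<bar>x - real n * \<alpha> - of_int m\<bar> | m :: int. gcd (int n) m = 1}"
    by (rule bdd_belowI[of _ 0]) auto
qed

lemma coprime_dist_attained:
  obtains m :: int where "gcd (int n) m = 1"
    and "coprime_dist n x \<alpha> = \<bar>x - real n * \<alpha> - of_int m\<bar>"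
proof -
  define y where "y = x - real n * \<alpha>"
  define f where "f = (\<lambda>m::int. \<bar>y - of_int m\<bar>)"
  define T where "T = {m. gcd (int n) m = 1 \<and> f m \<le> f 1}"
  have "T \<subseteq> {\<lfloor>y - f 1\<rfloor>..\<lceil>y + f 1\<rceil>}"
  proof
    fix m assume "m \<in> T"
    then have "\<bar>y - of_int m\<bar> \<le> f 1" by (simp add: T_def f_def)
    then have "y - f 1 \<le> of_int m" "of_int m \<le> y + f 1" by linarith+
    then show "m \<in> {\<lfloor>y - f 1\<rfloor>..\<lceil>y + f 1\<rceil>}"
      by (simp) linarith
  qed
  then have fin: "finite T" by (rule finite_subset) simp
  have "1 \<in> T" by (simp add: T_def)
  obtain m where m: "m \<in> T" "\<And>k. k \<in> T \<Longrightarrow> f m \<le> f k"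
    using fin \<open>1 \<in> T\<close>
    by (metis arg_min_if_finite(1) arg_min_least empty_iff)
  have le: "f m \<le> f k" if "gcd (int n) k = 1" for k
  proof (cases "f k \<le> f 1")
    case True
    then show ?thesis using m(2) that by (simp add: T_def)
  next
    case False
    then show ?thesis using m(2)[OF \<open>1 \<in> T\<close>] by simp
  qed
  have g: "gcd (int n) m = 1" using m(1) by (simp add: T_def)
  have "Inf {f k | k. gcd (int n) k = 1} = f m"
    by (rule cInf_eq_minimum) (use g le in auto)
  then have "coprime_dist n x \<alpha> = \<bar>x - real n * \<alpha> - of_int m\<bar>"
    by (simp add: coprime_dist_def f_def y_def)
  with g show thesis by (rule that)
qed

end

theory Submission
  imports Defs
begin

text \<open>
  By Lebesgue's differentiation theorem it suffices that, for every \<open>\<epsilon>\<close> and \<open>n\<^sub>0\<close>, the balls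
  \<open>B(n\<alpha> + m, \<epsilon>/n)\<close> with \<open>n \<ge> n\<^sub>0\<close> and \<open>gcd(n, m) = 1\<close> fill a proportion of every interval \<open>I\<close>
  that is bounded below independently of \<open>I\<close>. Let \<open>N\<close> be a denominator of a convergent of \<open>\<alpha>\<close>.
  The points \<open>n\<alpha> + m\<close> with \<open>0 < n < N\<close> are \<open>1/(2N)\<close>-separated, so the balls of radius
  \<open>min(\<epsilon>, 1/4)/N\<close> around them are disjoint, and only a lower bound of order \<open>N|I|\<close> for the number of
  coprime pairs with \<open>n\<alpha> + m \<in> I\<close> is needed.

  To count them, write \<open>(n, m)\<close> in the unimodular basis of two consecutive convergents with
  denominators \<open>q\<^sub>k\<close>, \<open>q\<^sub>k\<^sub>+\<^sub>1\<close>, where \<open>k\<close> is such that \<open>K q\<^sub>k q\<^sub>k\<^sub>+\<^sub>1 \<le> N < K q\<^sub>k\<^sub>+\<^sub>1 q\<^sub>k\<^sub>+\<^sub>2\<close>. The coordinates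
  \<open>(s, t)\<close> then range over a parallelogram with \<open>S < s \<le> 2S\<close> and \<open>t\<close> in an interval of length
  \<open>L\<close> of order \<open>q\<^sub>k\<^sub>+\<^sub>1\<close>, with \<open>|t| \<le> T\<close> also of order \<open>q\<^sub>k\<^sub>+\<^sub>1\<close>. As every common divisor is at most
  \<open>min(2S, T)\<close>, the error terms of the sieve by all \<open>d \<ge> 2\<close> are negligible, and its main term
  removes at most the proportion \<open>\<Sum> 1/d\<^sup>2 < 3/4\<close> of the pairs.
\<close>

section \<open>Convergents\<close>

text \<open>
  Index \<open>0\<close> is the formal convergent \<open>1/0\<close> and index \<open>1\<close> is \<open>\<lfloor>\<alpha>\<rfloor>/1\<close>; \<open>cf_num\<close> is the
  negated numerator, so that \<open>cf_err\<close> is \<open>|q\<alpha> + p|\<close> for \<open>q = cf_den\<close> and \<open>p = cf_num\<close>. For rational \<open>\<alpha>\<close> the recursion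
  eventually divides by \<open>0\<close> and has no meaning.
\<close>

fun cf_err :: "real \<Rightarrow> nat \<Rightarrow> real" where
  "cf_err \<alpha> 0 = 1"
| "cf_err \<alpha> (Suc 0) = frac \<alpha>"
| "cf_err \<alpha> (Suc (Suc k)) = cf_err \<alpha> k - of_int \<lfloor>cf_err \<alpha> k / cf_err \<alpha> (Suc k)\<rfloor> * cf_err \<alpha> (Suc k)"

fun cf_den :: "real \<Rightarrow> nat \<Rightarrow> int" where
  "cf_den \<alpha> 0 = 0"
| "cf_den \<alpha> (Suc 0) = 1"
| "cf_den \<alpha> (Suc (Suc k)) = cf_den \<alpha> k + \<lfloor>cf_err \<alpha> k / cf_err \<alpha> (Suc k)\<rfloor> * cf_den \<alpha> (Suc k)"

fun cf_num :: "real \<Rightarrow> nat \<Rightarrow> int" where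
  "cf_num \<alpha> 0 = - 1"
| "cf_num \<alpha> (Suc 0) = - \<lfloor>\<alpha>\<rfloor>"
| "cf_num \<alpha> (Suc (Suc k)) = cf_num \<alpha> k + \<lfloor>cf_err \<alpha> k / cf_err \<alpha> (Suc k)\<rfloor> * cf_num \<alpha> (Suc k)"

lemma cf_value:
  "of_int (cf_den \<alpha> k) * \<alpha> + of_int (cf_num \<alpha> k) = - ((-1) ^ k) * cf_err \<alpha> k"
proof (induction \<alpha> k rule: cf_err.induct)
  case (3 \<alpha> k)
  let ?a = "of_int \<lfloor>cf_err \<alpha> k / cf_err \<alpha> (Suc k)\<rfloor> :: real"
  have "of_int (cf_den \<alpha> (Suc (Suc k))) * \<alpha> + of_int (cf_num \<alpha> (Suc (Suc k)))
    = (of_int (cf_den \<alpha> k) * \<alpha> + of_int (cf_num \<alpha> k))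
      + ?a * (of_int (cf_den \<alpha> (Suc k)) * \<alpha> + of_int (cf_num \<alpha> (Suc k)))"
    by (simp add: algebra_simps)
  also have "\<dots> = - ((-1) ^ Suc (Suc k)) * cf_err \<alpha> (Suc (Suc k))"
    unfolding 3 by (simp add: algebra_simps)
  finally show ?case .
qed (auto simp: frac_def)

text \<open>Each step adds a multiple of one column of the matrix to the other and swaps them, so
  the determinant only changes sign. The pairs of two consecutive convergents therefore form a basis
  of the integer lattice.\<close>

lemma cf_det:
  "cf_den \<alpha> (Suc k) * cf_num \<alpha> k - cf_den \<alpha> k * cf_num \<alpha> (Suc k) = - ((-1) ^ k)"
  by (induction k) (simp_all add: algebra_simps)

text \<open>Cramer's rule with determinant \<open>- u\<close>; as \<open>u\<close> is its own
  inverse, the solution is integral.\<close>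

lemma cf_basis:
  obtains s t where "n = s * cf_den \<alpha> (Suc k) + t * cf_den \<alpha> k"
    "m = s * cf_num \<alpha> (Suc k) + t * cf_num \<alpha> k"
proof
  define q q' p p' and u :: int where "q = cf_den \<alpha> k" and "q' = cf_den \<alpha> (Suc k)"
    and "p = cf_num \<alpha> k" and "p' = cf_num \<alpha> (Suc k)" and "u = (-1) ^ k"
  have d: "q' * p - q * p' = - u" and u: "u * u = 1"
    using cf_det[of \<alpha> k] by (simp_all add: q_def q'_def p_def p'_def u_def flip: power_mult_distrib)
  have "n = - u * (- u) * n" "m = - u * (- u) * m" using u by auto
  then have "n = - u * (q' * p - q * p') * n" "m = - u * (q' * p - q * p') * m" by (simp_all only: d)
  then show "n = (- u * (n * p - m * q)) * cf_den \<alpha> (Suc k) + (- u * (m * q' - n * p')) * cf_den \<alpha> k"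
    "m = (- u * (n * p - m * q)) * cf_num \<alpha> (Suc k) + (- u * (m * q' - n * p')) * cf_num \<alpha> k"
    by (simp_all add: algebra_simps flip: q_def q'_def p_def p'_def)
qed

text \<open>Inverting the change of basis shows that a common divisor of the image divides
  \<open>s\<close> and \<open>t\<close> times a determinant of \<pm>1.\<close>

lemma cf_coprime:
  assumes "coprime s t"
  shows "coprime (s * cf_den \<alpha> (Suc k) + t * cf_den \<alpha> k) (s * cf_num \<alpha> (Suc k) + t * cf_num \<alpha> k)"
proof (rule coprimeI)
  define q q' p p' where "q = cf_den \<alpha> k" and "q' = cf_den \<alpha> (Suc k)"
    and "p = cf_num \<alpha> k" and "p' = cf_num \<alpha> (Suc k)"
  have d: "q' * p - q * p' = - ((-1) ^ k)"
    using cf_det[of \<alpha> k] by (simp add: q_def q'_def p_def p'_def)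
  fix g assume "g dvd s * cf_den \<alpha> (Suc k) + t * cf_den \<alpha> k"
    and "g dvd s * cf_num \<alpha> (Suc k) + t * cf_num \<alpha> k"
  then have g: "g dvd s * q' + t * q" "g dvd s * p' + t * p"
    by (simp_all add: q_def q'_def p_def p'_def)
  have "g dvd p * (s * q' + t * q) - q * (s * p' + t * p)"
    "g dvd q' * (s * p' + t * p) - p' * (s * q' + t * q)" using g by simp_all
  then have "g dvd s * (q' * p - q * p')" "g dvd t * (q' * p - q * p')"
    by (simp_all add: algebra_simps)
  then have "g dvd s" "g dvd t" unfolding d by (cases "even k"; simp)+
  with assms show "is_unit g" by (metis coprime_common_divisor)
qed

text \<open>These are the remainders of Euclid's algorithm on 1 and \<open>frac \<alpha>\<close>:
  the next one is the current one times a fractional part. It cannot vanish, since \<alpha> would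
  then be a quotient of integers.\<close>

lemma cf_err_pos_decr:
  assumes "\<alpha> \<notin> \<rat>"
  shows "0 < cf_err \<alpha> (Suc k) \<and> cf_err \<alpha> (Suc k) < cf_err \<alpha> k"
proof (induction k)
  case 0
  have "frac \<alpha> \<noteq> 0" using assms by (metis frac_eq_0_iff Ints_subset_Rats subsetD)
  then show ?case using frac_ge_0[of \<alpha>] frac_lt_1[of \<alpha>] by simp
next
  case (Suc k)
  have e: "cf_err \<alpha> (Suc (Suc k)) = cf_err \<alpha> (Suc k) * frac (cf_err \<alpha> k / cf_err \<alpha> (Suc k))"
    using Suc by (simp add: frac_def field_simps)
  have "cf_err \<alpha> (Suc (Suc k)) \<noteq> 0"
  proof
    assume "cf_err \<alpha> (Suc (Suc k)) = 0"
    then have v: "of_int (cf_den \<alpha> (Suc (Suc k))) * \<alpha> = - of_int (cf_num \<alpha> (Suc (Suc k)))"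
      using cf_value[of \<alpha> "Suc (Suc k)"] by simp
    \<comment> \<open>A zero denominator would make the numerator zero too, against the determinant
      \<pm>1.\<close>
    have "cf_den \<alpha> (Suc (Suc k)) \<noteq> 0"
    proof
      assume z: "cf_den \<alpha> (Suc (Suc k)) = 0"
      with v have "cf_num \<alpha> (Suc (Suc k)) = 0" by (simp del: cf_den.simps cf_num.simps)
      with z cf_det[of \<alpha> "Suc k"] show False by (simp del: cf_den.simps cf_num.simps)
    qed
    then have "\<alpha> = - of_int (cf_num \<alpha> (Suc (Suc k))) / of_int (cf_den \<alpha> (Suc (Suc k)))"
      using v by (simp add: field_simps del: cf_den.simps cf_num.simps)
    also have "\<dots> \<in> \<rat>" by (intro Rats_divide Rats_minus_iff[THEN iffD2] Rats_of_int)
    finally show False using assms by simp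
  qed
  with e Suc frac_ge_0[of "cf_err \<alpha> k / cf_err \<alpha> (Suc k)"] frac_lt_1[of "cf_err \<alpha> k / cf_err \<alpha> (Suc k)"]
  show ?case by (simp add: mult_less_cancel_left_pos order_less_le del: cf_err.simps)
qed

text \<open>Since the errors decrease, every partial quotient is at least 1, which gives growth at
  least like the Fibonacci numbers.\<close>

lemma cf_den_ge:
  assumes "\<alpha> \<notin> \<rat>"
  shows "cf_den \<alpha> k + cf_den \<alpha> (Suc k) \<le> cf_den \<alpha> (Suc (Suc k)) \<and> 0 \<le> cf_den \<alpha> k \<and> 1 \<le> cf_den \<alpha> (Suc k)"
proof (induction k)
  case 0
  show ?case using cf_err_pos_decr[OF assms, of 0] by (auto simp: le_floor_iff)
next
  case (Suc k)
  have "1 \<le> \<lfloor>cf_err \<alpha> (Suc k) / cf_err \<alpha> (Suc (Suc k))\<rfloor>"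
    using cf_err_pos_decr[OF assms, of "Suc k"] by (simp add: le_floor_iff del: cf_err.simps)
  moreover have "0 \<le> cf_den \<alpha> (Suc k)" "1 \<le> cf_den \<alpha> (Suc (Suc k))" using Suc by auto
  ultimately show ?case
    by (simp only: cf_den.simps(3)[of \<alpha> "Suc k"]) (simp add: mult_le_cancel_right1 del: cf_den.simps)
qed

lemma cf_den_mono: assumes "\<alpha> \<notin> \<rat>" shows "mono (cf_den \<alpha>)"
  unfolding mono_iff_le_Suc
proof
  fix k show "cf_den \<alpha> k \<le> cf_den \<alpha> (Suc k)"
    using cf_den_ge[OF assms, of "k - 1"] by (cases k) auto
qed

lemma cf_den_ge_index: assumes "\<alpha> \<notin> \<rat>" shows "int k \<le> cf_den \<alpha> (Suc k)"
proof (induction k)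
  case (Suc k)
  show ?case
  proof (cases k)
    case (Suc j)
    then show ?thesis using Suc.IH cf_den_ge[OF assms, of k] cf_den_ge[OF assms, of j]
      by (simp del: cf_den.simps)
  qed (use cf_den_ge[OF assms, of 1] in simp)
qed simp

text \<open>The left side is invariant under the recursion: the two contributions of the partial
  quotient cancel.\<close>

lemma cf_den_err:
  "of_int (cf_den \<alpha> (Suc k)) * cf_err \<alpha> k + of_int (cf_den \<alpha> k) * cf_err \<alpha> (Suc k) = 1"
  by (induction k) (simp_all add: algebra_simps)

text \<open>Of the two nonnegative terms in \<open>cf_den_err\<close>, which sum to 1, this is the
  larger one.\<close>

lemma cf_den_err_bounds:
  assumes "\<alpha> \<notin> \<rat>"
  shows "1 / 2 \<le> of_int (cf_den \<alpha> (Suc k)) * cf_err \<alpha> k" "of_int (cf_den \<alpha> (Suc k)) * cf_err \<alpha> k \<le> 1"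
proof -
  have e: "0 < cf_err \<alpha> (Suc k)" "cf_err \<alpha> (Suc k) < cf_err \<alpha> k" using cf_err_pos_decr[OF assms] by auto
  have q: "0 \<le> cf_den \<alpha> k" "cf_den \<alpha> k \<le> cf_den \<alpha> (Suc k)"
    using cf_den_ge[OF assms] cf_den_mono[OF assms] by (auto simp: monoD)
  then have "of_int (cf_den \<alpha> k) * cf_err \<alpha> (Suc k) \<le> of_int (cf_den \<alpha> (Suc k)) * cf_err \<alpha> k"
    using e by (intro mult_mono) auto
  moreover have "0 \<le> of_int (cf_den \<alpha> k) * cf_err \<alpha> (Suc k)" using q e by simp
  ultimately show "1 / 2 \<le> of_int (cf_den \<alpha> (Suc k)) * cf_err \<alpha> k"
    "of_int (cf_den \<alpha> (Suc k)) * cf_err \<alpha> k \<le> 1" using cf_den_err[of \<alpha> k] by linarith+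
qed

text \<open>Best approximation property. In the basis of the convergents \<open>k\<close> and
  \<open>k + 1\<close>, the bound on \<open>n\<close> forces coordinates of opposite signs, or
  \<open>s = 0\<close>. The values of the two convergents have opposite signs as well, so the
  contributions add up, and \<open>t \<noteq> 0\<close> alone contributes
  \<open>cf_err \<alpha> k\<close>.\<close>

lemma cf_best_approx:
  assumes "\<alpha> \<notin> \<rat>" and n: "\<bar>n\<bar> < cf_den \<alpha> (Suc k)" and nz: "n \<noteq> 0 \<or> m \<noteq> 0"
  shows "cf_err \<alpha> k \<le> \<bar>of_int n * \<alpha> + of_int m\<bar>"
proof -
  obtain s t where st: "n = s * cf_den \<alpha> (Suc k) + t * cf_den \<alpha> k"
    "m = s * cf_num \<alpha> (Suc k) + t * cf_num \<alpha> k" by (rule cf_basis)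
  have e: "0 < cf_err \<alpha> (Suc k)" "0 < cf_err \<alpha> k" using cf_err_pos_decr[OF assms(1), of k] by auto
  have q: "0 \<le> cf_den \<alpha> k" using cf_den_ge[OF assms(1)] by auto
  have "of_int n * \<alpha> + of_int m = of_int s * (of_int (cf_den \<alpha> (Suc k)) * \<alpha> + of_int (cf_num \<alpha> (Suc k)))
     + of_int t * (of_int (cf_den \<alpha> k) * \<alpha> + of_int (cf_num \<alpha> k))"
    by (simp add: st algebra_simps)
  also have "\<dots> = (-1) ^ k * (of_int s * cf_err \<alpha> (Suc k) - of_int t * cf_err \<alpha> k)"
    unfolding cf_value by (simp add: algebra_simps)
  finally have v: "\<bar>of_int n * \<alpha> + of_int m\<bar> = \<bar>of_int s * cf_err \<alpha> (Suc k) - of_int t * cf_err \<alpha> k\<bar>"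
    by (simp add: abs_mult)
  \<comment> \<open>Otherwise \<open>s \<noteq> 0\<close> and \<open>t\<close> does not oppose it in
    sign, so \<bar>n\<bar> would be at least \<open>cf_den \<alpha> (Suc k)\<close>.\<close>
  have "s = 0 \<and> t \<noteq> 0 \<or> 0 < s \<and> t < 0 \<or> s < 0 \<and> 0 < t"
  proof (rule ccontr)
    assume c: "\<not> ?thesis"
    have "\<not> (s = 0 \<and> t = 0)" using nz st by auto
    with c consider "0 < s" "0 \<le> t" | "s < 0" "t \<le> 0" by linarith
    then show False
    proof cases
      case 1
      then have "1 * cf_den \<alpha> (Suc k) \<le> s * cf_den \<alpha> (Suc k)" "0 \<le> t * cf_den \<alpha> k"
        using q n by (intro mult_right_mono mult_nonneg_nonneg; simp)+
      then show False using n st by linarith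
    next
      case 2
      then have "s * cf_den \<alpha> (Suc k) \<le> (-1) * cf_den \<alpha> (Suc k)" "t * cf_den \<alpha> k \<le> 0"
        using q n by (intro mult_right_mono mult_nonpos_nonneg; simp)+
      then show False using n st by linarith
    qed
  qed
  then consider "s = 0" "t \<noteq> 0" | "0 < s" "t \<le> -1" | "s < 0" "1 \<le> t" by force
  then show ?thesis
  proof cases
    case 1
    then have "1 \<le> \<bar>of_int t :: real\<bar>" by linarith
    with 1 e show ?thesis unfolding v by (simp add: abs_mult)
  next
    case 2
    then have "0 \<le> of_int s * cf_err \<alpha> (Suc k)" "of_int t * cf_err \<alpha> k \<le> (-1) * cf_err \<alpha> k"
      using e by (intro mult_right_mono mult_nonneg_nonneg; simp)+
    then show ?thesis unfolding v by linarith
  next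
    case 3
    then have "of_int s * cf_err \<alpha> (Suc k) \<le> 0" "1 * cf_err \<alpha> k \<le> of_int t * cf_err \<alpha> k"
      using e by (intro mult_right_mono mult_nonpos_nonneg; simp)+
    then show ?thesis unfolding v by linarith
  qed
qed

lemma cf_pair_inj:
  assumes "s * cf_den \<alpha> (Suc k) + t * cf_den \<alpha> k = s' * cf_den \<alpha> (Suc k) + t' * cf_den \<alpha> k"
    and "s * cf_num \<alpha> (Suc k) + t * cf_num \<alpha> k = s' * cf_num \<alpha> (Suc k) + t' * cf_num \<alpha> k"
  shows "s = s' \<and> t = t'"
proof -
  define q q' p p' where "q = cf_den \<alpha> k" and "q' = cf_den \<alpha> (Suc k)"
    and "p = cf_num \<alpha> k" and "p' = cf_num \<alpha> (Suc k)"
  have d: "q' * p - q * p' = - ((-1) ^ k)"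
    using cf_det[of \<alpha> k] by (simp add: q_def q'_def p_def p'_def)
  have e: "(s - s') * q' + (t - t') * q = 0" "(s - s') * p' + (t - t') * p = 0"
    using assms by (simp_all add: q_def q'_def p_def p'_def algebra_simps)
  have "(s - s') * (q' * p - q * p') = p * ((s - s') * q' + (t - t') * q) - q * ((s - s') * p' + (t - t') * p)"
    "(t - t') * (q' * p - q * p') = q' * ((s - s') * p' + (t - t') * p) - p' * ((s - s') * q' + (t - t') * q)"
    by (simp_all add: algebra_simps)
  then show ?thesis unfolding e d by simp
qed

text \<open>Couples the two scales: the denominator of index \<open>Suc l\<close> governs
  separation, while the convergents \<open>k\<close> and \<open>k + 1\<close> supply the
  coordinates. The lower bound makes the range of \<open>s\<close> long, the upper bound keeps
  \<open>t\<close> of the order of \<open>cf_den \<alpha> (Suc k)\<close>. First \<open>l\<close> is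
  taken large, then \<open>k\<close> least.\<close>

lemma cf_scale:
  fixes K :: real
  assumes "\<alpha> \<notin> \<rat>" and K: "1 \<le> K"
  obtains k l where "k0 \<le> k"
    and "K * of_int (cf_den \<alpha> k) * of_int (cf_den \<alpha> (Suc k)) \<le> of_int (cf_den \<alpha> (Suc l))"
    and "of_int (cf_den \<alpha> (Suc l)) < K * of_int (cf_den \<alpha> (Suc k)) * of_int (cf_den \<alpha> (Suc (Suc k)))"
proof -
  define h where "h k = K * of_int (cf_den \<alpha> k) * of_int (cf_den \<alpha> (Suc k))" for k
  obtain l where "h k0 \<le> real l" using real_arch_simple by blast
  also have "real l \<le> of_int (cf_den \<alpha> (Suc l))" using cf_den_ge_index[OF assms(1), of l] by linarith
  finally have l: "h k0 \<le> of_int (cf_den \<alpha> (Suc l))" .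
  define N where "N = (of_int (cf_den \<alpha> (Suc l)) :: real)"
  have ex: "\<exists>k. k0 \<le> k \<and> N < h (Suc k)"
  proof -
    obtain j where j: "N < real j" using reals_Archimedean2 by blast
    define k where "k = max k0 j"
    have "real j \<le> real k" by (simp add: k_def)
    also have "\<dots> \<le> of_int (cf_den \<alpha> (Suc k))" using cf_den_ge_index[OF assms(1), of k] by linarith
    also have "\<dots> \<le> K * of_int (cf_den \<alpha> (Suc k))"
      using K cf_den_ge[OF assms(1), of k] by (simp add: mult_le_cancel_right1)
    also have "\<dots> = K * of_int (cf_den \<alpha> (Suc k)) * 1" by simp
    also have "\<dots> \<le> h (Suc k)"
      unfolding h_def using K cf_den_ge[OF assms(1), of k] cf_den_ge[OF assms(1), of "Suc k"]
      by (intro mult_left_mono) (simp_all del: cf_den.simps)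
    finally show ?thesis using j by (intro exI[of _ k]) (simp add: k_def)
  qed
  define k where "k = (LEAST k. k0 \<le> k \<and> N < h (Suc k))"
  have k: "k0 \<le> k" "N < h (Suc k)" using LeastI_ex[OF ex] by (simp_all add: k_def)
  have "h k \<le> N"
  proof (cases "k = k0")
    case False
    then obtain j where j: "k = Suc j" "k0 \<le> j" using k(1) by (cases k) auto
    have "\<not> (k0 \<le> j \<and> N < h (Suc j))" 
      using not_less_Least[of j "\<lambda>k. k0 \<le> k \<and> N < h (Suc k)"] j(1) by (simp add: k_def)
    then show ?thesis using j by simp
  qed (use l N_def in simp)
  with k show thesis by (intro that[of k l]) (simp_all add: h_def N_def del: cf_den.simps)
qed

section \<open>Coprime pairs in a sheared rectangle\<close>

lemma card_int_interval:
  fixes c h :: real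
  shows "finite {t::int. \<bar>of_int t - c\<bar> < h}"
    and "0 \<le> h \<Longrightarrow> real (card {t::int. \<bar>of_int t - c\<bar> < h}) \<le> 2 * h + 1"
    and "2 * h - 1 \<le> real (card {t::int. \<bar>of_int t - c\<bar> < h})"
proof -
  have e: "{t::int. \<bar>of_int t - c\<bar> < h} = {\<lfloor>c - h\<rfloor> + 1..\<lceil>c + h\<rceil> - 1}"
    by (auto simp: abs_less_iff; linarith)
  show "finite {t::int. \<bar>of_int t - c\<bar> < h}" unfolding e by simp
  have c: "real (card {t::int. \<bar>of_int t - c\<bar> < h}) = max 0 (of_int (\<lceil>c + h\<rceil> - 1 - \<lfloor>c - h\<rfloor>))"
    unfolding e by simp
  show "real (card {t::int. \<bar>of_int t - c\<bar> < h}) \<le> 2 * h + 1" if "0 \<le> h"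
    unfolding c using that by simp linarith
  show "2 * h - 1 \<le> real (card {t::int. \<bar>of_int t - c\<bar> < h})"
    unfolding c by (simp; linarith)
qed

lemma finite_multiples_interval: "finite {t::int. d dvd t \<and> \<bar>of_int t - (c::real)\<bar> < h}"
  by (rule finite_subset[OF _ card_int_interval(1)[of c h]]) auto

text \<open>Writing \<open>t = d * u\<close> shrinks the interval by the factor
  \<open>d\<close>.\<close>

lemma card_multiples_interval:
  fixes c h :: real
  assumes "0 \<le> h" "0 < d"
  shows "real (card {t::int. d dvd t \<and> \<bar>of_int t - c\<bar> < h}) \<le> 2 * h / of_int d + 1"
proof -
  have "{t::int. d dvd t \<and> \<bar>of_int t - c\<bar> < h} \<subseteq> (\<lambda>u. d * u) ` {u. \<bar>of_int u - c / of_int d\<bar> < h / of_int d}"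
  proof (clarsimp elim!: dvdE)
    fix u :: int assume "\<bar>of_int d * of_int u - c\<bar> < h"
    moreover have "of_int d * of_int u - c = of_int d * (of_int u - c / of_int d)"
      using assms(2) by (simp add: right_diff_distrib)
    ultimately have "of_int d * \<bar>of_int u - c / of_int d\<bar> < h"
      using assms(2) by (simp add: abs_mult)
    then have "\<bar>of_int u - c / of_int d\<bar> < h / of_int d"
      using assms(2) by (simp add: pos_less_divide_eq mult.commute)
    then show "d * u \<in> (*) d ` {u. \<bar>of_int u - c / of_int d\<bar> < h / of_int d}" by blast
  qed
  then have "card {t::int. d dvd t \<and> \<bar>of_int t - c\<bar> < h}
      \<le> card {u::int. \<bar>of_int u - c / of_int d\<bar> < h / of_int d}"
    by (rule surj_card_le[OF card_int_interval(1)])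
  also have "real \<dots> \<le> 2 * (h / of_int d) + 1" using assms by (intro card_int_interval) simp
  finally show ?thesis by simp
qed

text \<open>Telescoping, with equality at \<open>D = 2\<close>. A bound below 1 is what lets a union
  bound over all \<open>d\<close> leave a positive proportion.\<close>

lemma sum_inverse_squares_le: "2 \<le> D \<Longrightarrow> (\<Sum>d = 2..D. 1 / real d ^ 2) \<le> 3 / 4 - 1 / real D"
proof (induction D rule: nat_induct_at_least)
  case (Suc D)
  have "1 / real (Suc D) ^ 2 \<le> 1 / (real D * real (Suc D))"
    using Suc(1) by (intro divide_left_mono) (auto simp: power2_eq_square)
  also have "\<dots> = 1 / real D - 1 / real (Suc D)" using Suc(1) by (simp add: field_simps)
  finally show ?case using Suc by (simp del: of_nat_Suc)
qed simp

text \<open>A square root in place of a logarithm suffices for the error terms of the sieve, and it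
  telescopes.\<close>

lemma sum_inverse_le: "(\<Sum>d = 2..D. 1 / real d) \<le> 2 * sqrt (real D)"
proof (induction D)
  case (Suc D)
  have "1 / real (Suc D) \<le> 2 * sqrt (real (Suc D)) - 2 * sqrt (real D)"
  proof -
    have "sqrt (real D) * sqrt (real (Suc D)) \<le> (real D + real (Suc D)) / 2"
      by (rule arith_geo_mean_sqrt[unfolded real_sqrt_mult]) auto
    then have "1 \<le> (2 * sqrt (real (Suc D)) - 2 * sqrt (real D)) * sqrt (real (Suc D))"
      by (simp add: algebra_simps)
    moreover have "0 \<le> 2 * sqrt (real (Suc D)) - 2 * sqrt (real D)" by simp
    moreover have "sqrt (real (Suc D)) \<le> real (Suc D)"
      by (rule real_le_lsqrt) (auto simp: power2_eq_square mult_le_cancel_right1)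
    ultimately have "1 \<le> (2 * sqrt (real (Suc D)) - 2 * sqrt (real D)) * real (Suc D)"
      by (meson mult_left_mono order_trans)
    then show ?thesis by (simp add: divide_le_eq)
  qed
  with Suc show ?case by (cases "D = 0") (simp_all del: of_nat_Suc)
qed simp

text \<open>Union bound over all possible common divisors \<open>d \<ge> 2\<close>, prime or not.
  The numerical hypotheses make each of the three error terms at most
  \<open>S * L / 32\<close>.\<close>

lemma card_coprime_pairs:
  fixes S :: nat and L T :: real and c :: "int \<Rightarrow> real"
  assumes S: "8192 \<le> S" and L: "128 \<le> L" and T: "sqrt T \<le> L / 64"
    and bd: "\<And>s t. s \<in> {int S<..2 * int S} \<Longrightarrow> \<bar>of_int t - c s\<bar> < L / 2 \<Longrightarrow> \<bar>of_int t\<bar> \<le> T"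
  defines "P \<equiv> SIGMA s:{int S<..2 * int S}. {t. \<bar>of_int t - c s\<bar> < L / 2}"
  shows "real S * L / 8 \<le> real (card {(s, t) \<in> P. coprime s t})" "finite P"
proof -
  define X where "X = {int S<..2 * int S}"
  define A where "A s = {t. \<bar>of_int t - c s\<bar> < L / 2}" for s
  define D where "D = nat (min (2 * int S) \<lfloor>T\<rfloor>)"
  define B where "B d = (SIGMA s:{s \<in> X. d dvd s}. {t. d dvd t \<and> \<bar>of_int t - c s\<bar> < L / 2})" for d
  have P: "P = Sigma X A" unfolding P_def X_def A_def ..
  have finA: "finite (A s)" for s unfolding A_def by (rule card_int_interval)
  show finP: "finite P" unfolding P X_def by (intro finite_SigmaI finA) auto
  have finX: "finite X" and cX: "card X = S" by (simp_all add: X_def)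
  \<comment> \<open>A row of length \<open>L\<close> is nonempty, so \<open>T\<close> bounds some
    absolute value; without this, truncation by \<open>nat\<close> would spoil
    \<open>D \<le> T\<close>.\<close>
  have T0: "0 \<le> T"
  proof -
    have "int S + 1 \<in> X" using S by (simp add: X_def)
    have "2 * (L / 2) - 1 \<le> real (card (A (int S + 1)))" unfolding A_def by (rule card_int_interval)
    then have "A (int S + 1) \<noteq> {}" using L by auto
    then show ?thesis using bd[of "int S + 1"] \<open>int S + 1 \<in> X\<close> unfolding A_def X_def by force
  qed
  have D2S: "real D \<le> 2 * real S" unfolding D_def by linarith
  have DT: "real D \<le> T" unfolding D_def using T0 by linarith
  have "real S * (L - 1) = (\<Sum>s\<in>X. L - 1)" by (simp add: cX)
  also have "\<dots> \<le> (\<Sum>s\<in>X. real (card (A s)))"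
    using card_int_interval(3)[of "L / 2"] by (intro sum_mono) (simp add: A_def)
  also have "\<dots> = real (card P)" unfolding P using finA by (subst card_SigmaI) (auto simp: X_def)
  finally have cP: "real S * (L - 1) \<le> real (card P)" .
  \<comment> \<open>Pairs with \<open>t = 0\<close> are removed separately: their gcd is
    \<open>s\<close>, which \<open>T\<close> need not bound.\<close>
  have sub: "P \<subseteq> {(s, t) \<in> P. coprime s t} \<union> (X \<times> {0} \<union> (\<Union>d\<in>{2..D}. B (int d)))"
  proof
    fix z assume "z \<in> P"
    obtain s t where z: "z = (s, t)" by force
    with \<open>z \<in> P\<close> have st: "(s, t) \<in> P" by simp
    have "coprime s t" if *: "(s, t) \<notin> X \<times> {0} \<union> (\<Union>d\<in>{2..D}. B (int d))"
    proof (rule ccontr)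
      assume nc: "\<not> coprime s t"
      have sX: "s \<in> X" and tA: "\<bar>of_int t - c s\<bar> < L / 2" using st by (auto simp: P A_def)
      have "t \<noteq> 0" using * sX by auto
      have "0 < s" using sX by (simp add: X_def)
      have "gcd s t \<le> s" "gcd s t \<le> \<bar>t\<bar>"
        using \<open>t \<noteq> 0\<close> \<open>0 < s\<close> by (auto intro!: zdvd_imp_le)
      moreover have "\<bar>t\<bar> \<le> \<lfloor>T\<rfloor>" using bd[of s t] sX tA by (simp add: X_def le_floor_iff)
      moreover have "2 \<le> gcd s t"
      proof -
        have "gcd s t \<noteq> 1" using nc by (simp add: coprime_iff_gcd_eq_1)
        moreover have "0 < gcd s t" using \<open>0 < s\<close> by simp
        ultimately show ?thesis by linarith
      qed
      moreover have "s \<le> 2 * int S" using sX by (simp add: X_def)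
      ultimately have "2 \<le> gcd s t" "gcd s t \<le> min (2 * int S) \<lfloor>T\<rfloor>" by linarith+
      then have "nat (gcd s t) \<in> {2..D}" unfolding D_def by (simp only: atLeastAtMost_iff nat_mono) simp
      moreover have "(s, t) \<in> B (int (nat (gcd s t)))" using sX tA by (auto simp: B_def)
      ultimately show False using * by blast
    qed
    then show "z \<in> {(s, t) \<in> P. coprime s t} \<union> (X \<times> {0} \<union> (\<Union>d\<in>{2..D}. B (int d)))"
      using z st by blast
  qed
  have cB: "real (card (B (int d))) \<le> (real S / real d + 1) * (L / real d + 1)" if "d \<in> {2..D}" for d
  proof -
    \<comment> \<open>The half-integral ends \<open>S + 1/2\<close> and \<open>2 * S + 1/2\<close>
      give an open interval of length exactly \<open>S\<close>.\<close>
    have "{s \<in> X. int d dvd s} \<subseteq> {s. int d dvd s \<and> \<bar>of_int s - (3 * real S + 1) / 2\<bar> < real S / 2}"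
    proof
      fix s assume s: "s \<in> {s \<in> X. int d dvd s}"
      then have "int S + 1 \<le> s" "s \<le> 2 * int S" by (simp_all add: X_def)
      then have "real S + 1 \<le> of_int s" "of_int s \<le> 2 * real S" by linarith+
      then have "\<bar>of_int s - (3 * real S + 1) / 2\<bar> < real S / 2"
        unfolding abs_less_iff by (simp add: field_simps)
      then show "s \<in> {s. int d dvd s \<and> \<bar>of_int s - (3 * real S + 1) / 2\<bar> < real S / 2}"
        using s by simp
    qed
    then have "card {s \<in> X. int d dvd s} \<le> card {s. int d dvd s \<and> \<bar>of_int s - (3 * real S + 1) / 2\<bar> < real S / 2}"
      by (intro card_mono finite_multiples_interval)
    also have "real \<dots> \<le> 2 * (real S / 2) / of_int (int d) + 1"
      using that by (intro card_multiples_interval) auto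
    finally have c1: "real (card {s \<in> X. int d dvd s}) \<le> real S / real d + 1" by simp
    have "real (card (B (int d))) = (\<Sum>s\<in>{s \<in> X. int d dvd s}. real (card {t. int d dvd t \<and> \<bar>of_int t - c s\<bar> < L / 2}))"
      unfolding B_def
      using finite_multiples_interval
      by (subst card_SigmaI) (simp_all add: finX del: less_divide_eq_numeral1)
    also have "\<dots> \<le> (\<Sum>s\<in>{s \<in> X. int d dvd s}. L / real d + 1)"
      using that L card_multiples_interval[of "L / 2" "int d"] by (intro sum_mono) simp
    also have "\<dots> = real (card {s \<in> X. int d dvd s}) * (L / real d + 1)" by simp
    also have "\<dots> \<le> (real S / real d + 1) * (L / real d + 1)"
      using c1 L by (intro mult_right_mono) auto
    finally show ?thesis .
  qed
  have "card P \<le> card ({(s, t) \<in> P. coprime s t} \<union> (X \<times> {0} \<union> (\<Union>d\<in>{2..D}. B (int d))))"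
  proof (rule card_mono[OF _ sub])
    have "finite {(s, t) \<in> P. coprime s t}" "finite (B d)" for d
      by (rule finite_subset[OF _ finP]; auto simp: P A_def B_def)+
    then show "finite ({(s, t) \<in> P. coprime s t} \<union> (X \<times> {0} \<union> (\<Union>d\<in>{2..D}. B (int d))))"
      by (simp add: X_def)
  qed
  also have "\<dots> \<le> card {(s, t) \<in> P. coprime s t} + (card (X \<times> {0::int}) + (\<Sum>d = 2..D. card (B (int d))))"
    by (intro order_trans[OF card_Un_le] add_left_mono card_UN_le order_trans[OF card_Un_le] add_mono) auto
  finally have "real (card P) \<le> real (card {(s, t) \<in> P. coprime s t}) + (real S + (\<Sum>d = 2..D. real (card (B (int d)))))"
    by (simp add: cX card_cartesian_product flip: of_nat_sum of_nat_add)
  moreover have "(\<Sum>d = 2..D. real (card (B (int d)))) \<le> 3 / 4 * (real S * L) + 3 / 32 * (real S * L) - real S * 2"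
  proof -
    have "(\<Sum>d = 2..D. real (card (B (int d)))) \<le> (\<Sum>d = 2..D. (real S / real d + 1) * (L / real d + 1))"
      by (intro sum_mono cB)
    also have "\<dots> = real S * L * (\<Sum>d = 2..D. 1 / real d ^ 2) + (real S + L) * (\<Sum>d = 2..D. 1 / real d) + real (D - 1)"
    proof -
      have "(real S / real d + 1) * (L / real d + 1)
          = real S * L * (1 / real d ^ 2) + (real S + L) * (1 / real d) + 1" for d
        by (simp add: algebra_simps add_divide_distrib power2_eq_square)
      then show ?thesis by (simp only: sum.distrib flip: sum_distrib_left) simp
    qed
    also have "\<dots> \<le> real S * L * (3 / 4) + (real S * (2 * sqrt T) + L * (2 * sqrt (2 * real S))) + 2 * real S"
    proof (intro add_mono mult_left_mono)
      show "(\<Sum>d = 2..D. 1 / (real d)\<^sup>2) \<le> 3 / 4"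
      proof (cases "2 \<le> D")
        case True
        then show ?thesis using sum_inverse_squares_le[OF True] by (smt (verit) of_nat_0_le_iff divide_nonneg_nonneg)
      qed simp
      \<comment> \<open>Both bounds on \<open>D\<close> are used: \<open>sqrt T\<close> is small
        against \<open>L\<close>, and \<open>sqrt (2 * S)\<close> is small against
        \<open>S\<close>.\<close>
      have "(\<Sum>d = 2..D. 1 / real d) \<le> 2 * sqrt T" "(\<Sum>d = 2..D. 1 / real d) \<le> 2 * sqrt (2 * real S)"
        using sum_inverse_le[of D] DT D2S by (meson order_trans mult_left_mono real_sqrt_le_mono zero_le_numeral)+
      then show "(real S + L) * (\<Sum>d = 2..D. 1 / real d) \<le> real S * (2 * sqrt T) + L * (2 * sqrt (2 * real S))"
        using L unfolding distrib_right by (intro add_mono mult_left_mono) auto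
    qed (use L D2S in auto)
    also have "L * (2 * sqrt (2 * real S)) \<le> L * (real S / 32)"
    proof -
      have "real S * 8192 \<le> real S * real S" using S by (intro mult_left_mono) auto
      then have "sqrt (2 * real S) \<le> real S / 64"
        by (intro real_le_lsqrt) (auto simp: power2_eq_square)
      then show ?thesis using L by (intro mult_left_mono) auto
    qed
    also have "real S * (2 * sqrt T) \<le> real S * (L / 32)" using T by (intro mult_left_mono) auto
    \<comment> \<open>The saved \<open>2 * S\<close> pays for the pairs with \<open>t = 0\<close>
      and for the loss of 1 per row in \<open>cP\<close>. What remains is \<open>5/32\<close> of
      \<open>S * L\<close>.\<close>
    also have "2 * real S \<le> real S * L / 32 - 2 * real S" 
    proof -
      have "real S * 128 \<le> real S * L" using L by (intro mult_left_mono) auto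
      then show ?thesis by simp
    qed
    finally show ?thesis by (simp add: algebra_simps)
  qed
  ultimately show "real S * L / 8 \<le> real (card {(s, t) \<in> P. coprime s t})"
    using cP by (simp add: algebra_simps)
qed

section \<open>Values of the linear form at coprime pairs\<close>

lemma coprime_values_in_interval:
  fixes \<alpha> x w M :: real
  assumes irr: "\<alpha> \<notin> \<rat>" and w: "0 < w"
  obtains N :: real and G :: "(int \<times> int) set"
  where "M \<le> N" "0 < N" "finite G" "N * w / 24 \<le> real (card G)"
    "\<And>n m. (n, m) \<in> G \<Longrightarrow> coprime n m \<and> M \<le> of_int n \<and> 0 < n \<and> of_int n < N \<and> \<bar>of_int n * \<alpha> + of_int m - x\<bar> < w"
    "\<And>n m n' m'. (n, m) \<in> G \<Longrightarrow> (n', m') \<in> G \<Longrightarrow> (n, m) \<noteq> (n', m') \<Longrightarrow>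
       1 / (2 * N) \<le> \<bar>(of_int n * \<alpha> + of_int m) - (of_int n' * \<alpha> + of_int m')\<bar>"
proof -
  define R where "R = \<bar>x\<bar> + w"
  \<comment> \<open>\<open>R\<close> bounds the values of the form. With this \<open>K\<close> one
    gets \<open>S \<ge> q\<close> and \<open>S \<ge> 2 * R * q\<close>, so the term
    \<open>q * (\<sigma> * v s t)\<close> in \<open>n\<delta>\<close> is at most
    \<open>S / 2\<close>.\<close>
  define K where "K = 24 * R + 12"
  have R: "0 < R" using w by (simp add: R_def)
  \<comment> \<open>Lower bounds for \<open>q\<close>, giving in turn \<open>S \<ge> 8192\<close>,
    \<open>L \<ge> 128\<close>, \<open>sqrt T \<le> L / 64\<close> and
    \<open>n \<ge> M\<close>.\<close>
  obtain j where j: "Max {8192, 64 / w, 2048 * (K + R) / w\<^sup>2, M} \<le> real j" using real_arch_simple by blast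
  obtain k l where k: "Suc j \<le> k"
    and lo: "K * of_int (cf_den \<alpha> k) * of_int (cf_den \<alpha> (Suc k)) \<le> of_int (cf_den \<alpha> (Suc l))"
    and hi: "of_int (cf_den \<alpha> (Suc l)) < K * of_int (cf_den \<alpha> (Suc k)) * of_int (cf_den \<alpha> (Suc (Suc k)))"
    using cf_scale[OF irr, of K "Suc j"] R by (auto simp: K_def simp del: cf_den.simps)
  define q Q Q' N :: real where "q = of_int (cf_den \<alpha> k)" and "Q = of_int (cf_den \<alpha> (Suc k))"
    and "Q' = of_int (cf_den \<alpha> (Suc (Suc k)))" and "N = of_int (cf_den \<alpha> (Suc l))"
  define \<delta> \<delta>' \<sigma> where "\<delta> = cf_err \<alpha> k" and "\<delta>' = cf_err \<alpha> (Suc k)" and "\<sigma> = (-1 :: real) ^ k"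
  have lo: "K * q * Q \<le> N" and hi: "N < K * Q * Q'"
    using lo hi by (simp_all only: q_def Q_def Q'_def N_def)
  have \<delta>: "0 < \<delta>" "0 < \<delta>'" using cf_err_pos_decr[OF irr, of k] by (auto simp: \<delta>_def \<delta>'_def)
  have Q\<delta>: "1 / 2 \<le> Q * \<delta>" "Q * \<delta> \<le> 1" "Q' * \<delta>' \<le> 1" "Q * \<delta> + q * \<delta>' = 1"
    using cf_den_err_bounds[OF irr, of k] cf_den_err_bounds[OF irr, of "Suc k"] cf_den_err[of \<alpha> k]
    by (simp_all only: Q_def Q'_def q_def \<delta>_def \<delta>'_def)
  have "int j \<le> cf_den \<alpha> k" "cf_den \<alpha> k \<le> cf_den \<alpha> (Suc k)"
    using cf_den_ge_index[OF irr, of j] monoD[OF cf_den_mono[OF irr] k] monoD[OF cf_den_mono[OF irr], of k "Suc k"]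
    by (simp_all del: cf_den.simps)
  then have "real j \<le> q" and qQ: "q \<le> Q" by (simp_all add: q_def Q_def)
  with j have q: "8192 \<le> q" "64 / w \<le> q" "2048 * (K + R) / w\<^sup>2 \<le> q" "M \<le> q" by auto
  have "12 * (q * 1) \<le> K * (q * Q)" using R q qQ by (intro mult_mono) (auto simp: K_def)
  then have N: "0 < N" "12 * q \<le> N" using lo q by (simp_all only: mult.assoc; linarith)+
  \<comment> \<open>The factor \<open>1/3\<close> leaves room for the perturbation by
    \<open>S / 2\<close>: \<open>n * \<delta>\<close> is at most \<open>5/2 * S\<close>, still below
    \<open>N * \<delta>\<close>.\<close>
  define S where "S = nat \<lfloor>N * \<delta> / 3\<rfloor>"
  have N\<delta>: "K * q \<le> 2 * (N * \<delta>)"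
  proof -
    have "K * q * (1 / 2) \<le> K * q * (Q * \<delta>)" using R q Q\<delta> by (intro mult_left_mono) (auto simp: K_def)
    also have "\<dots> \<le> N * \<delta>" using lo \<delta> by (simp add: mult_right_mono flip: mult.assoc)
    finally show ?thesis by simp
  qed
  have Kq: "12 * q \<le> K * q" "24 * (R * q) \<le> K * q"
    using R q by (simp_all add: K_def distrib_right)
  have S: "real S \<le> N * \<delta> / 3" "N * \<delta> / 6 \<le> real S"
    unfolding S_def using N \<delta> N\<delta> Kq q by (simp_all, linarith+)
  have S': "8192 \<le> real S" "2 * (R * q) \<le> real S" using S N\<delta> Kq q by linarith+
  define L where "L = 2 * w / \<delta>"
  define T where "T = 2 * (K + R) * Q"
  have i\<delta>: "Q \<le> 1 / \<delta>" "1 / \<delta> \<le> 2 * Q" using Q\<delta> \<delta> by (simp_all add: field_simps)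
  have L: "2 * w * Q \<le> L" using mult_left_mono[OF i\<delta>(1), of "2 * w"] w by (simp add: L_def)
  have L128: "128 \<le> L"
  proof -
    have "64 \<le> w * q" using q w by (simp add: field_simps)
    also have "\<dots> \<le> w * Q" using qQ w by simp
    finally show ?thesis using L by (simp add: mult.commute mult.left_commute)
  qed
  have TL: "sqrt T \<le> L / 64"
  proof -
    have "2048 * (K + R) \<le> w\<^sup>2 * q" using q w by (simp add: field_simps)
    also have "\<dots> \<le> w\<^sup>2 * Q" using qQ w by simp
    finally have "2048 * (K + R) * Q \<le> w\<^sup>2 * Q * Q" using q qQ by (intro mult_right_mono) auto
    then have "T \<le> (w * Q / 32)\<^sup>2" by (simp add: T_def power2_eq_square field_simps)
    moreover have "w * Q / 32 \<le> L / 64" using L by (simp add: mult.commute mult.left_commute)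
    ultimately have "T \<le> (L / 64)\<^sup>2" using w q qQ by (smt (verit) power_mono divide_nonneg_nonneg mult_nonneg_nonneg)
    then show ?thesis using L128 by (intro real_le_lsqrt) auto
  qed
  txt \<open>The integer points are parametrised as \<open>s\<close> times the convergent \<open>k + 1\<close> plus \<open>t\<close> times the
    convergent \<open>k\<close>: by unimodularity \<open>gcd (n, m) = gcd (s, t)\<close>, and the value is within \<open>w\<close> of \<open>x\<close>
    exactly when \<open>t\<close> is within \<open>L / 2\<close> of \<open>c s\<close>.\<close>
  define c where "c s = (of_int s * \<delta>' - \<sigma> * x) / \<delta>" for s :: int
  define n m where "n s t = s * cf_den \<alpha> (Suc k) + t * cf_den \<alpha> k"
    and "m s t = s * cf_num \<alpha> (Suc k) + t * cf_num \<alpha> k" for s t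
  define v where "v s t = of_int (n s t) * \<alpha> + of_int (m s t)" for s t
  have \<sigma>: "\<sigma> * \<sigma> = 1" "\<bar>\<sigma>\<bar> = 1" by (simp_all add: \<sigma>_def flip: power_mult_distrib)
  have v: "v s t = \<sigma> * (of_int s * \<delta>' - of_int t * \<delta>)" for s t
  proof -
    have "v s t = of_int s * (of_int (cf_den \<alpha> (Suc k)) * \<alpha> + of_int (cf_num \<alpha> (Suc k)))
      + of_int t * (of_int (cf_den \<alpha> k) * \<alpha> + of_int (cf_num \<alpha> k))"
      by (simp add: v_def n_def m_def algebra_simps)
    then show ?thesis unfolding cf_value by (simp add: \<delta>_def \<delta>'_def \<sigma>_def algebra_simps)
  qed
  have \<sigma>v: "\<sigma> * v s t = of_int s * \<delta>' - of_int t * \<delta>" for s t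
    unfolding v using \<sigma> by (simp flip: mult.assoc)
  \<comment> \<open>So \<open>n\<close> is \<open>s / \<delta>\<close> up to a small correction, and
    the range of \<open>s\<close> controls that of \<open>n\<close>.\<close>
  have n\<delta>: "of_int (n s t) * \<delta> = of_int s - q * (\<sigma> * v s t)" for s t
  proof -
    have "of_int (n s t) * \<delta> = of_int s * (Q * \<delta>) + of_int t * q * \<delta>"
      by (simp add: n_def Q_def q_def algebra_simps)
    also have "Q * \<delta> = 1 - q * \<delta>'" using Q\<delta>(4) by simp
    finally show ?thesis unfolding \<sigma>v by (simp add: algebra_simps)
  qed
  have near: "\<bar>v s t - x\<bar> < w" if "\<bar>of_int t - c s\<bar> < L / 2" for s t
  proof -
    have "v s t - x = - \<sigma> * (\<delta> * (of_int t - c s))"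
    proof -
      have "\<delta> * (of_int t - c s) = of_int t * \<delta> - of_int s * \<delta>' + \<sigma> * x"
      proof -
        have "\<delta> * c s = of_int s * \<delta>' - \<sigma> * x" using \<delta> by (simp add: c_def)
        then show ?thesis by (simp add: right_diff_distrib)
      qed
      moreover have "\<sigma> * (\<sigma> * x) = x" using \<sigma> by (simp flip: mult.assoc)
      ultimately show ?thesis unfolding v by (simp add: algebra_simps)
    qed
    then have "\<bar>v s t - x\<bar> = \<delta> * \<bar>of_int t - c s\<bar>" using \<sigma> \<delta> by (simp add: abs_mult)
    also have "\<dots> < \<delta> * (L / 2)" using that \<delta> by simp
    finally show ?thesis using \<delta> by (simp add: L_def)
  qed
  have vR: "\<bar>\<sigma> * v s t\<bar> < R" if "\<bar>of_int t - c s\<bar> < L / 2" for s t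
    using near[OF that] \<sigma> by (simp add: abs_mult R_def)
  have bd: "\<bar>of_int t\<bar> \<le> T" if s: "s \<in> {int S<..2 * int S}" and t: "\<bar>of_int t - c s\<bar> < L / 2" for s t
  proof -
    have "of_int t * \<delta> = of_int s * \<delta>' - \<sigma> * v s t" using \<sigma>v[of s t] by simp
    moreover have "0 \<le> of_int s * \<delta>'" using s \<delta> by simp
    \<comment> \<open>This is where the upper bound on \<open>N\<close> enters, as \<open>s\<close>
      is at most \<open>N * \<delta>\<close>.\<close>
    moreover have "of_int s * \<delta>' \<le> K"
    proof -
      have "of_int s \<le> 2 * real S" using s by simp
      also have "\<dots> \<le> N * \<delta>" using S(1) mult_pos_pos[OF N(1) \<delta>(1)] by linarith
      also have "\<dots> \<le> K * Q * Q' * \<delta>" using hi \<delta> by (intro mult_right_mono) auto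
      finally have "of_int s * \<delta>' \<le> K * Q * Q' * \<delta> * \<delta>'" using \<delta> by (intro mult_right_mono) auto
      also have "\<dots> = K * ((Q * \<delta>) * (Q' * \<delta>'))" by (simp only: ac_simps)
      also have "\<dots> \<le> K * (1 * 1)"
      proof (intro mult_left_mono mult_mono)
        show "0 \<le> Q' * \<delta>'"
          using \<delta> cf_den_ge[OF irr, of "Suc k"] by (simp add: Q'_def del: cf_den.simps)
      qed (use R Q\<delta> in \<open>auto simp: K_def\<close>)
      finally show ?thesis by simp
    qed
    ultimately have "\<bar>of_int t * \<delta>\<bar> \<le> K + R" using vR[OF t] by linarith
    then have "\<bar>of_int t\<bar> \<le> (K + R) * (1 / \<delta>)" using \<delta> by (simp add: abs_mult field_simps)
    also have "\<dots> \<le> (K + R) * (2 * Q)" using i\<delta> R by (intro mult_left_mono) (auto simp: K_def)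
    finally show ?thesis by (simp add: T_def algebra_simps)
  qed
  define P where "P = (SIGMA s:{int S<..2 * int S}. {t. \<bar>of_int t - c s\<bar> < L / 2})"
  define P' where "P' = {(s, t) \<in> P. coprime s t}"
  have cP: "real S * L / 8 \<le> real (card P')" and finP: "finite P"
    unfolding P'_def P_def using S'(1) by (intro card_coprime_pairs[OF _ L128 TL bd]; simp)+
  define G where "G = (\<lambda>(s, t). (n s t, m s t)) ` P'"
  have G: "M \<le> of_int (n s t) \<and> 0 < n s t \<and> of_int (n s t) < N \<and> \<bar>v s t - x\<bar> < w" if "(s, t) \<in> P" for s t
  proof -
    have t: "\<bar>of_int t - c s\<bar> < L / 2" and s: "real S \<le> of_int s" "of_int s \<le> 2 * real S"
      using that by (auto simp: P_def)
    have "\<bar>q * (\<sigma> * v s t)\<bar> \<le> q * R" using vR[OF t] q by (simp add: abs_mult)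
    then have "\<bar>q * (\<sigma> * v s t)\<bar> \<le> real S / 2" using S' by (simp add: mult.commute)
    then have "real S / 2 \<le> of_int (n s t) * \<delta>" "of_int (n s t) * \<delta> \<le> 5 / 2 * real S"
      unfolding n\<delta> using s by linarith+
    moreover have "0 < N * \<delta>" using N \<delta> by simp
    ultimately have "N / 12 * \<delta> \<le> of_int (n s t) * \<delta>" "of_int (n s t) * \<delta> < N * \<delta>" using S by linarith+
    then have "N / 12 \<le> of_int (n s t)" "of_int (n s t) < N" using \<delta> by simp_all
    moreover have "M \<le> N / 12" "0 < N / 12" using N q by simp_all
    ultimately show ?thesis using near[OF t] by auto
  qed
  show thesis
  proof (rule that)
    show "M \<le> N" "0 < N" using N q by auto
    show "finite G" unfolding G_def P'_def by (intro finite_imageI finite_subset[OF _ finP]) auto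
    have "N * \<delta> / 6 * L / 8 \<le> real S * L / 8" using S L128 by (intro divide_right_mono mult_right_mono) auto
    also note cP
    also have "card P' = card G"
      unfolding G_def by (rule card_image[symmetric]) (auto simp: inj_on_def n_def m_def dest: cf_pair_inj)
    finally show "N * w / 24 \<le> real (card G)" using \<delta> by (simp add: L_def)
  next
    fix n' m' assume "(n', m') \<in> G"
    then obtain s t where st: "(s, t) \<in> P" "coprime s t" "n' = n s t" "m' = m s t" by (auto simp: G_def P'_def)
    show "coprime n' m' \<and> M \<le> of_int n' \<and> 0 < n' \<and> of_int n' < N \<and> \<bar>of_int n' * \<alpha> + of_int m' - x\<bar> < w"
      using G[OF st(1)] cf_coprime[OF st(2), of \<alpha> k] st(3,4) by (simp add: v_def n_def m_def)
  next
    fix n1 m1 n2 m2 assume g: "(n1, m1) \<in> G" "(n2, m2) \<in> G" and ne: "(n1, m1) \<noteq> (n2, m2)"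
    have "0 < n1" "of_int n1 < N" "0 < n2" "of_int n2 < N" using g G by (auto simp: G_def P'_def)
    \<comment> \<open>Both values of \<open>n\<close> lie strictly between 0 and a convergent
      denominator, so best approximation separates the points.\<close>
    then have "\<bar>n1 - n2\<bar> < cf_den \<alpha> (Suc l)" by (simp add: N_def)
    then have "cf_err \<alpha> l \<le> \<bar>of_int (n1 - n2) * \<alpha> + of_int (m1 - m2)\<bar>"
      using ne by (intro cf_best_approx[OF irr]) auto
    moreover have "1 / (2 * N) \<le> cf_err \<alpha> l"
      using cf_den_err_bounds(1)[OF irr, of l] N by (simp add: N_def field_simps)
    ultimately show "1 / (2 * N) \<le> \<bar>(of_int n1 * \<alpha> + of_int m1) - (of_int n2 * \<alpha> + of_int m2)\<bar>"
      by (simp add: algebra_simps)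
  qed
qed

section \<open>Passage to full measure\<close>

text \<open>Lebesgue differentiation of the indicator of \<open>E\<close>: at almost every point
  outside \<open>E\<close> the averages over \<open>{x..x + h}\<close> tend to 0, against the lower
  bound \<open>c\<close>.\<close>

lemma AE_mem_if_dense_in_intervals:
  fixes E :: "real set"
  assumes E: "E \<in> sets lebesgue" and c: "0 < c"
    and dense: "\<And>x h. 0 < h \<Longrightarrow> c * h \<le> measure lebesgue (E \<inter> {x..x + h})"
  shows "AE x in lebesgue. x \<in> E"
proof -
  let ?f = "indicator E :: real \<Rightarrow> real"
  have m: "E \<inter> {a..b} \<in> lmeasurable" for a b
    using E by (metis Int_commute cbox_interval lmeasurable_cbox fmeasurable_Int_fmeasurable)
  have "?f integrable_on cbox a b" for a b
    using m[of a b] by (simp add: integrable_on_indicator)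
  then obtain Z where Z: "negligible Z"
    and lim: "\<And>x e. x \<notin> Z \<Longrightarrow> 0 < e \<Longrightarrow> \<exists>d>0. \<forall>h. 0 < h \<and> h < d \<longrightarrow>
      norm (integral (cbox x (x + h *\<^sub>R One)) ?f /\<^sub>R h ^ DIM(real) - ?f x) < e"
    using integrable_ccontinuous_explicit[of ?f] by metis
  have "x \<in> E" if x: "x \<notin> Z" for x
  proof (rule ccontr)
    assume "x \<notin> E"
    obtain d where d: "0 < d" "\<And>h. 0 < h \<Longrightarrow> h < d \<Longrightarrow> \<bar>integral {x..x + h} ?f / h\<bar> < c"
      using lim[OF x c] \<open>x \<notin> E\<close> by (auto simp: divide_inverse_commute)
    have "integral {x..x + d / 2} ?f = measure lebesgue (E \<inter> {x..x + d / 2})"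
      using m[of x "x + d / 2"] by (simp add: integral_indicator)
    then show False using d(2)[of "d / 2"] d(1) dense[of "d / 2" x] by (simp add: field_simps abs_if split: if_splits)
  qed
  then show ?thesis using Z by (intro AE_I'[of Z]) (auto simp: negligible_iff_null_sets)
qed

lemma measure_disjoint_balls_ge:
  fixes E :: "real set"
  assumes "finite G" "E \<in> lmeasurable" and r: "0 \<le> r" and sub: "\<And>z. z \<in> G \<Longrightarrow> ball (f z) r \<subseteq> E"
    and sep: "\<And>y z. y \<in> G \<Longrightarrow> z \<in> G \<Longrightarrow> y \<noteq> z \<Longrightarrow> 2 * r \<le> \<bar>f y - f z\<bar>"
  shows "real (card G) * (2 * r) \<le> measure lebesgue E"
proof -
  have disj: "disjoint_family_on (\<lambda>z. ball (f z) r) G"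
    unfolding disjoint_family_on_def using sep by (fastforce simp: dist_real_def)
  have "real (card G) * (2 * r) = (\<Sum>z\<in>G. measure lebesgue (ball (f z) r))"
    using r by (simp add: ball_eq_greaterThanLessThan)
  also have "\<dots> = measure lebesgue (\<Union>z\<in>G. ball (f z) r)"
    using disj assms(1) by (intro measure_finite_Union[symmetric]) (auto simp: ball_eq_greaterThanLessThan r)
  also have "\<dots> \<le> measure lebesgue E"
    using sub assms(1,2) by (intro measure_mono_fmeasurable) auto
  finally show ?thesis .
qed

lemma liminf_eq_0:
  fixes f :: "nat \<Rightarrow> real"
  assumes nn: "\<And>n. 0 \<le> f n" and ex: "\<And>e n0. 0 < e \<Longrightarrow> \<exists>n\<ge>n0. f n < e"
  shows "liminf (\<lambda>n. ereal (f n)) = 0"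
proof (rule ccontr)
  have "0 \<le> liminf (\<lambda>n. ereal (f n))" by (rule Liminf_bounded) (simp add: nn)
  moreover assume "liminf (\<lambda>n. ereal (f n)) \<noteq> 0"
  ultimately have "0 < liminf (\<lambda>n. ereal (f n))" by simp
  then obtain e where e: "0 < ereal e" "ereal e < liminf (\<lambda>n. ereal (f n))"
    using ereal_dense2 by blast
  from less_LiminfD[OF e(2)] obtain n0 where "\<And>n. n0 \<le> n \<Longrightarrow> e < f n"
    by (auto simp: eventually_sequentially)
  with ex[of e n0] e(1) show False by fastforce
qed

text \<open>Membership for all \<epsilon> of the form \<open>1 / (j + 1)\<close> and all
  \<open>n0\<close> forces the liminf to be 0. Each single set is open, hence measurable.\<close>

definition coprime_approx :: "real \<Rightarrow> real \<Rightarrow> nat \<Rightarrow> real set" where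
  "coprime_approx \<alpha> \<epsilon> n0 =
     {\<gamma>. \<exists>n m. n0 \<le> n \<and> 0 < n \<and> coprime (int n) m \<and> \<bar>\<gamma> - real n * \<alpha> - of_int m\<bar> < \<epsilon> / real n}"

lemma open_coprime_approx: "open (coprime_approx \<alpha> \<epsilon> n0)"
proof -
  have "coprime_approx \<alpha> \<epsilon> n0 = (\<Union>n\<in>{n. n0 \<le> n \<and> 0 < n}. \<Union>m\<in>{m. coprime (int n) m}.
      ball (real n * \<alpha> + of_int m) (\<epsilon> / real n))"
    by (fastforce simp: coprime_approx_def dist_real_def abs_minus_commute diff_diff_add)
  then show ?thesis by auto
qed

text \<open>All balls get the common radius \<open>r\<close>, at most \<open>\<epsilon> / n\<close>
  because \<open>n < N\<close>. The cap \<open>1/4\<close> makes them disjoint. Centres within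
  \<open>h / 4\<close> of the midpoint and \<open>r \<le> h / 4\<close> keep them inside the
  interval. The factor \<open>N\<close> cancels, so the proportion depends on \<epsilon>
  alone.\<close>

lemma measure_coprime_approx_ge:
  assumes irr: "\<alpha> \<notin> \<rat>" and \<epsilon>: "0 < \<epsilon>" and h: "0 < h"
  shows "min \<epsilon> (1 / 4) / 48 * h \<le> measure lebesgue (coprime_approx \<alpha> \<epsilon> n0 \<inter> {x..x + h})"
proof -
  obtain N G where N: "max (real n0) (1 / h) \<le> N" "0 < N"
    and G: "finite G" "N * (h / 4) / 24 \<le> real (card G)"
    and val: "\<And>n m. (n, m) \<in> G \<Longrightarrow> coprime n m \<and> max (real n0) (1 / h) \<le> of_int n \<and> 0 < n \<and> of_int n < N \<and>
       \<bar>of_int n * \<alpha> + of_int m - (x + h / 2)\<bar> < h / 4"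
    and sep: "\<And>n m n' m'. (n, m) \<in> G \<Longrightarrow> (n', m') \<in> G \<Longrightarrow> (n, m) \<noteq> (n', m') \<Longrightarrow>
       1 / (2 * N) \<le> \<bar>(of_int n * \<alpha> + of_int m) - (of_int n' * \<alpha> + of_int m')\<bar>"
    using coprime_values_in_interval[OF irr, of "h / 4" "max (real n0) (1 / h)" "x + h / 2"] h by auto
  define r where "r = min \<epsilon> (1 / 4) / N"
  have r: "0 < r" "r \<le> \<epsilon> / N" "2 * r \<le> 1 / (2 * N)"
    using \<epsilon> N by (auto simp: r_def field_simps)
  have rh: "r \<le> h / 4"
  proof -
    have "1 / N \<le> h" using N h by (simp add: field_simps)
    then show ?thesis using r(3) by simp
  qed
  have "min \<epsilon> (1 / 4) / 48 * h = N * (h / 4) / 24 * (2 * r)" using N by (simp add: r_def)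
  also have "\<dots> \<le> real (card G) * (2 * r)" using G r by (intro mult_right_mono) auto
  also have "\<dots> \<le> measure lebesgue (coprime_approx \<alpha> \<epsilon> n0 \<inter> {x..x + h})"
  proof (rule measure_disjoint_balls_ge[where f = "\<lambda>(n, m). of_int n * \<alpha> + of_int m"])
    show "coprime_approx \<alpha> \<epsilon> n0 \<inter> {x..x + h} \<in> lmeasurable"
      using fmeasurable_Int_fmeasurable[of "cbox x (x + h)" lebesgue "coprime_approx \<alpha> \<epsilon> n0"]
      by (simp add: Int_commute borel_open open_coprime_approx)
  next
    fix z assume "z \<in> G"
    then obtain n m where z: "z = (n, m)" "(n, m) \<in> G" by (cases z) auto
    show "ball (case z of (n, m) \<Rightarrow> of_int n * \<alpha> + of_int m) r \<subseteq> coprime_approx \<alpha> \<epsilon> n0 \<inter> {x..x + h}"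
    proof
      fix \<gamma> assume "\<gamma> \<in> ball (case z of (n, m) \<Rightarrow> of_int n * \<alpha> + of_int m) r"
      then have \<gamma>: "\<bar>\<gamma> - (of_int n * \<alpha> + of_int m)\<bar> < r" by (simp add: z dist_real_def abs_minus_commute)
      have v: "coprime n m" "real n0 \<le> of_int n" "0 < n" "of_int n < N"
        "\<bar>of_int n * \<alpha> + of_int m - (x + h / 2)\<bar> < h / 4" using val[OF z(2)] by auto
      have "\<epsilon> / N \<le> \<epsilon> / of_int n" using v N \<epsilon> by (intro divide_left_mono) auto
      then have "\<bar>\<gamma> - of_int n * \<alpha> - of_int m\<bar> < \<epsilon> / of_int n" using \<gamma> r(2) by (simp add: diff_diff_add)
      then have "\<gamma> \<in> coprime_approx \<alpha> \<epsilon> n0"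
        unfolding coprime_approx_def using v by (intro CollectI exI[of _ "nat n"] exI[of _ m]) auto
      moreover have "\<gamma> \<in> {x..x + h}" using \<gamma> v(5) rh unfolding abs_less_iff atLeastAtMost_iff by argo
      ultimately show "\<gamma> \<in> coprime_approx \<alpha> \<epsilon> n0 \<inter> {x..x + h}" by simp
    qed
  next
    fix y z assume yz: "y \<in> G" "z \<in> G" "y \<noteq> z"
    obtain n m n' m' where e: "y = (n, m)" "z = (n', m')" by (cases y, cases z)
    then show "2 * r \<le> \<bar>(case y of (n, m) \<Rightarrow> of_int n * \<alpha> + of_int m) - (case z of (n, m) \<Rightarrow> of_int n * \<alpha> + of_int m)\<bar>"
      using order_trans[OF r(3) sep[of n m n' m']] yz by simp
  qed (use G r in auto)
  finally show ?thesis .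
qed

theorem theorem1p2:
  fixes \<alpha> :: real
  assumes "\<alpha> \<notin> \<rat>"
  shows "AE \<gamma> in lebesgue.
    liminf (\<lambda>n. ereal (real n * coprime_dist n \<gamma> \<alpha>)) = 0"
proof -
  have "AE \<gamma> in lebesgue. \<gamma> \<in> coprime_approx \<alpha> (1 / real (Suc j)) n0" for j n0
    using assms
    by (intro AE_mem_if_dense_in_intervals[where c = "min (1 / real (Suc j)) (1 / 4) / 48"]
        measure_coprime_approx_ge) (auto simp: open_coprime_approx borel_open)
  \<comment> \<open>Only countably many conditions, since \<epsilon> runs through
    \<open>1 / (j + 1)\<close>.\<close>
  then have "AE \<gamma> in lebesgue. \<forall>j n0. \<gamma> \<in> coprime_approx \<alpha> (1 / real (Suc j)) n0"
    by (simp add: AE_all_countable)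
  then show ?thesis
  proof (rule AE_mp, intro AE_I2 impI)
    fix \<gamma> assume \<gamma>: "\<forall>j n0. \<gamma> \<in> coprime_approx \<alpha> (1 / real (Suc j)) n0"
    show "liminf (\<lambda>n. ereal (real n * coprime_dist n \<gamma> \<alpha>)) = 0"
    proof (rule liminf_eq_0)
      fix n show "0 \<le> real n * coprime_dist n \<gamma> \<alpha>"
        by (rule coprime_dist_attained[of n \<gamma> \<alpha>]) simp
    next
      fix e :: real and n0 :: nat assume "0 < e"
      then obtain j where j: "1 / real (Suc j) < e" using nat_approx_posE by blast
      obtain n m where n: "n0 \<le> n" "0 < n" "coprime (int n) m"
        and d: "\<bar>\<gamma> - real n * \<alpha> - of_int m\<bar> < 1 / real (Suc j) / real n"
        using \<gamma> unfolding coprime_approx_def by blast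
      have "coprime_dist n \<gamma> \<alpha> \<le> \<bar>\<gamma> - real n * \<alpha> - of_int m\<bar>"
        using n by (intro coprime_dist_le) (simp add: coprime_iff_gcd_eq_1)
      with d have "coprime_dist n \<gamma> \<alpha> < 1 / real (Suc j) / real n" by linarith
      then have "real n * coprime_dist n \<gamma> \<alpha> < 1 / real (Suc j)"
        using n(2) by (simp add: pos_less_divide_eq mult.commute del: of_nat_Suc divide_divide_eq_left)
      with j n(1) show "\<exists>n\<ge>n0. real n * coprime_dist n \<gamma> \<alpha> < e" by (intro exI[of _ n]) linarith
    qed
  qed
qed

end
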